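(* Let $m$ be a non-negative integer and assume that $\kappa\ge0$. Then $\Lambda_n^{\le m}\subset L^2(\mathbb{R}_+^n,d\mu^{(B)})$ if and only if $$a<-2(m+\kappa(n-1))+1.$$
   Context: Let $n\ge1$, let $a,\kappa$ be real parameters, and $\mathbb{R}_+=(0,\infty)$. $\Lambda_n\subset\mathbb{C}[x_1,\ldots,x_n]$ is the space of symmetric polynomials in $n$ variables with complex coefficients and $\Lambda_n^{\le m}=\bigoplus_{k=0}^m\Lambda_n^k$, where $\Lambda_n^k$ is the subspace of homogeneous symmetric polynomials of degree $k$. The measure is $$d\mu^{(B)}(x;a,\kappa)=\prod_{i=1}^nx_i^{a-2}e^{-2/x_i}\prod_{i<j}|x_i-x_j|^{2\kappa}\,dx_1\cdots dx_n.$$ *)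

theory Defs
  imports "HOL-Analysis.Analysis" "HOL-Library.Poly_Mapping" "HOL-Combinatorics.Permutations"
begin

text \<open>Polynomials in the variables \<open>x\<^sub>0, x\<^sub>1, \<dots>\<close>: finitely supported maps from exponent vectors to
  coefficients.  The \<open>n\<close> variables \<open>x\<^sub>1, \<dots>, x\<^sub>n\<close> of the text are indexed by \<open>{..<n}\<close>.\<close>

type_synonym cpoly = "(nat \<Rightarrow>\<^sub>0 nat) \<Rightarrow>\<^sub>0 complex"

definition polys_in :: "nat \<Rightarrow> cpoly set" where
  "polys_in n = {p. \<forall>e \<in> Poly_Mapping.keys p. Poly_Mapping.keys e \<subseteq> {..<n}}"

text \<open>The coefficient of \<open>x\<^sup>e\<close> in \<open>permute_vars \<pi> p\<close> is that of \<open>x\<^bsup>e \<circ> \<pi>\<^esup>\<close> in \<open>p\<close>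
  (\<open>Poly_Mapping.map_key f\<close> is precomposition with the injection \<open>f\<close>).\<close>

definition permute_vars :: "(nat \<Rightarrow> nat) \<Rightarrow> cpoly \<Rightarrow> cpoly" where
  "permute_vars \<pi> p = Poly_Mapping.map_key (Poly_Mapping.map_key \<pi>) p"

definition sym_polys :: "nat \<Rightarrow> cpoly set" where
  "sym_polys n = {p \<in> polys_in n. \<forall>\<pi>. \<pi> permutes {..<n} \<longrightarrow> permute_vars \<pi> p = p}"

definition monom_degree :: "(nat \<Rightarrow>\<^sub>0 nat) \<Rightarrow> nat" where
  "monom_degree e = (\<Sum>i \<in> Poly_Mapping.keys e. Poly_Mapping.lookup e i)"

definition homogeneous :: "nat \<Rightarrow> cpoly \<Rightarrow> bool" where
  "homogeneous k p \<longleftrightarrow> (\<forall>e \<in> Poly_Mapping.keys p. monom_degree e = k)"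

definition hom_sym_polys :: "nat \<Rightarrow> nat \<Rightarrow> cpoly set" where
  "hom_sym_polys n k = {p \<in> sym_polys n. homogeneous k p}"

text \<open>The sum of the spaces \<open>hom_sym_polys n k\<close> for \<open>k \<le> m\<close>; it is automatically direct.\<close>

definition sym_polys_le :: "nat \<Rightarrow> nat \<Rightarrow> cpoly set" where
  "sym_polys_le n m = {(\<Sum>k\<le>m. q k) | q. \<forall>k\<le>m. q k \<in> hom_sym_polys n k}"

definition poly_eval :: "cpoly \<Rightarrow> (nat \<Rightarrow> complex) \<Rightarrow> complex" where
  "poly_eval p z = (\<Sum>e \<in> Poly_Mapping.keys p. Poly_Mapping.lookup p e *
     (\<Prod>i \<in> Poly_Mapping.keys e. z i ^ Poly_Mapping.lookup e i))"

definition poly_fun :: "cpoly \<Rightarrow> (nat \<Rightarrow> real) \<Rightarrow> complex" where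
  "poly_fun p x = poly_eval p (\<lambda>i. complex_of_real (x i))"

text \<open>Lebesgue measure on \<open>(0, \<infinity>)\<^sup>n\<close>, points being extensional functions on \<open>{..<n}\<close>.\<close>

definition lborel_pos :: "nat \<Rightarrow> (nat \<Rightarrow> real) measure" where
  "lborel_pos n = PiM {..<n} (\<lambda>_. restrict_space lborel {0<..})"

text \<open>For \<open>\<kappa> = 0\<close> the convention \<open>0 powr 0 = 0\<close> changes the density only on the null set where two
  coordinates agree, so the measure is the intended one.\<close>

definition bessel_density :: "nat \<Rightarrow> real \<Rightarrow> real \<Rightarrow> (nat \<Rightarrow> real) \<Rightarrow> real" where
  "bessel_density n a \<kappa> x =
     (\<Prod>i<n. x i powr (a - 2) * exp (- 2 / x i)) *
     (\<Prod>j<n. \<Prod>i<j. \<bar>x i - x j\<bar> powr (2 * \<kappa>))"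

definition bessel_measure :: "nat \<Rightarrow> real \<Rightarrow> real \<Rightarrow> (nat \<Rightarrow> real) measure" where
  "bessel_measure n a \<kappa> = density (lborel_pos n) (\<lambda>x. ennreal (bessel_density n a \<kappa> x))"

text \<open>Functions rather than classes modulo null sets.\<close>

definition L2_space :: "'a measure \<Rightarrow> ('a \<Rightarrow> complex) set" where
  "L2_space M = {f \<in> borel_measurable M. integrable M (\<lambda>x. (norm (f x))\<^sup>2)}"

end

theory Submission
  imports Defs
begin

text \<open>Sufficiency: every monomial of degree at most \<open>m\<close> is bounded by \<open>\<Prod>(1 + x\<^sub>i)\<^sup>m\<close>, and
  \<open>\<bar>x\<^sub>i - x\<^sub>j\<bar> \<le> (1 + x\<^sub>i)(1 + x\<^sub>j)\<close>, so the integrand has a dominator of product form whose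
  one-dimensional factors decay like \<open>t\<close> to the power \<open>a - 2 + 2m + 2\<kappa>(n - 1)\<close> at infinity.
  Necessity: for the power sum of degree \<open>m\<close>, let one coordinate tend to infinity while the others stay in
  bounded, separated intervals; the integrand is then at least a constant times that same power of
  the large coordinate.\<close>

section \<open>Evaluation of polynomials and the power sums\<close>

text \<open>Exponents outside the support have coefficient zero. A common index set for
  \<open>p\<close>, \<open>q\<close> and \<open>p + q\<close> reduces additivity to distributing a
  sum, even when terms cancel.\<close>

lemma poly_eval_superset:
  assumes "finite S" "Poly_Mapping.keys p \<subseteq> S"
  shows "poly_eval p z = (\<Sum>e\<in>S. Poly_Mapping.lookup p e *
     (\<Prod>i \<in> Poly_Mapping.keys e. z i ^ Poly_Mapping.lookup e i))"
  unfolding poly_eval_def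
  by (rule sum.mono_neutral_left) (use assms in \<open>auto simp: in_keys_iff\<close>)

lemma poly_eval_add: "poly_eval (p + q) z = poly_eval p z + poly_eval q z"
proof -
  let ?S = "Poly_Mapping.keys p \<union> Poly_Mapping.keys q"
  have "poly_eval r z = (\<Sum>e\<in>?S. Poly_Mapping.lookup r e *
     (\<Prod>i \<in> Poly_Mapping.keys e. z i ^ Poly_Mapping.lookup e i))"
    if "r \<in> {p, q, p + q}" for r
    using that Poly_Mapping.keys_add[of p q] by (intro poly_eval_superset) auto
  then show ?thesis
    by (simp add: lookup_add algebra_simps sum.distrib)
qed

lemma poly_eval_sum: "poly_eval (\<Sum>i\<in>A. f i) z = (\<Sum>i\<in>A. poly_eval (f i) z)"
  by (induction A rule: infinite_finite_induct) (simp_all add: poly_eval_add, simp_all add: poly_eval_def)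

text \<open>The test polynomial for necessity: at positive points none of its terms is negative, so
  no cancellation can weaken growth in one coordinate. For \<open>m = 0\<close> it is the constant
  \<open>n\<close>.\<close>

definition power_sum :: "nat \<Rightarrow> nat \<Rightarrow> cpoly" where
  "power_sum n m = (\<Sum>i<n. Poly_Mapping.single (Poly_Mapping.single i m) 1)"

lemma poly_fun_power_sum: "poly_fun (power_sum n m) x = of_real (\<Sum>i<n. x i ^ m)"
proof -
  have "poly_eval (Poly_Mapping.single (Poly_Mapping.single i m) 1) z = z i ^ m" for i z
    by (simp add: poly_eval_def)
  then show ?thesis
    by (simp add: poly_fun_def power_sum_def poly_eval_sum)
qed

text \<open>\<open>map_key\<close> is precomposition for injective maps, so injectivity is needed
  twice: for \<open>\<pi>\<close> itself, and for the induced map on exponent vectors, where it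
  follows from surjectivity of \<open>\<pi>\<close>.\<close>

lemma lookup_permute_vars:
  assumes "\<pi> permutes A"
  shows "Poly_Mapping.lookup (permute_vars \<pi> p) e =
    Poly_Mapping.lookup p (Poly_Mapping.map_key \<pi> e)"
proof -
  have \<pi>: "inj \<pi>" "surj \<pi>" using assms by (simp_all add: permutes_inj permutes_surj)
  have "inj (Poly_Mapping.map_key \<pi> :: (nat \<Rightarrow>\<^sub>0 nat) \<Rightarrow> nat \<Rightarrow>\<^sub>0 nat)"
  proof (rule injI, rule poly_mapping_eqI)
    fix e e' :: "nat \<Rightarrow>\<^sub>0 nat" and k
    assume "Poly_Mapping.map_key \<pi> e = Poly_Mapping.map_key \<pi> e'"
    then have "Poly_Mapping.lookup e \<circ> \<pi> = Poly_Mapping.lookup e' \<circ> \<pi>"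
      using \<pi> by (metis map_key.rep_eq)
    then show "Poly_Mapping.lookup e k = Poly_Mapping.lookup e' k"
      using \<pi>(2) by (metis comp_apply surjD)
  qed
  then show ?thesis
    by (simp add: permute_vars_def map_key.rep_eq)
qed

text \<open>Since \<open>\<pi>\<close> is onto, an exponent vector is determined by its values at
  the points \<open>\<pi> k'\<close>. This moves the permutation from the exponent vector to the
  summation index.\<close>

lemma map_key_eq_single_iff:
  assumes "bij \<pi>"
  shows "Poly_Mapping.single i m = Poly_Mapping.map_key \<pi> e \<longleftrightarrow> Poly_Mapping.single (\<pi> i) m = e"
proof
  have inj: "inj \<pi>" using assms by (simp add: bij_is_inj)
  show "Poly_Mapping.single i m = Poly_Mapping.map_key \<pi> e" if "Poly_Mapping.single (\<pi> i) m = e"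
    using map_key_single[OF inj] that by metis
  show "Poly_Mapping.single (\<pi> i) m = e" if "Poly_Mapping.single i m = Poly_Mapping.map_key \<pi> e"
  proof (rule poly_mapping_eqI)
    fix k
    obtain k' where k: "k = \<pi> k'" using assms by (meson bij_pointE)
    have "Poly_Mapping.lookup e k = Poly_Mapping.lookup (Poly_Mapping.map_key \<pi> e) k'"
      using inj k by (simp add: map_key.rep_eq)
    then show "Poly_Mapping.lookup (Poly_Mapping.single (\<pi> i) m) k = Poly_Mapping.lookup e k"
      using inj k by (simp add: that[symmetric] lookup_single when_def inj_eq)
  qed
qed

lemma power_sum_hom_sym: "power_sum n m \<in> hom_sym_polys n m"
proof -
  have keys: "\<exists>i<n. e = Poly_Mapping.single i m" if "e \<in> Poly_Mapping.keys (power_sum n m)" for e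
  proof -
    have "e \<in> (\<Union>i\<in>{..<n}. Poly_Mapping.keys (Poly_Mapping.single (Poly_Mapping.single i m) (1::complex)))"
      using that unfolding power_sum_def by (rule subsetD[OF Poly_Mapping.keys_sum])
    then show ?thesis by auto
  qed
  have "permute_vars \<pi> (power_sum n m) = power_sum n m" if \<pi>: "\<pi> permutes {..<n}" for \<pi>
  proof (rule poly_mapping_eqI)
    fix e
    \<comment> \<open>Counting indices with \<open>when\<close> also covers \<open>m = 0\<close>,
      where all \<open>n\<close> exponent vectors coincide and the coefficient is
      \<open>n\<close>.\<close>
    have "Poly_Mapping.lookup (permute_vars \<pi> (power_sum n m)) e
        = (\<Sum>i<n. 1 when Poly_Mapping.single i m = Poly_Mapping.map_key \<pi> e)"
      by (simp add: lookup_permute_vars[OF \<pi>] power_sum_def lookup_sum lookup_single)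
    also have "\<dots> = (\<Sum>i<n. 1 when Poly_Mapping.single (\<pi> i) m = e)"
      by (simp add: map_key_eq_single_iff[OF permutes_bij[OF \<pi>]])
    also have "\<dots> = (\<Sum>i<n. 1 when Poly_Mapping.single i m = e)"
      using sum.permute[OF \<pi>, of "\<lambda>i. (1::complex) when Poly_Mapping.single i m = e"] by (simp add: comp_def)
    also have "\<dots> = Poly_Mapping.lookup (power_sum n m) e"
      by (simp add: power_sum_def lookup_sum lookup_single)
    finally show "Poly_Mapping.lookup (permute_vars \<pi> (power_sum n m)) e
        = Poly_Mapping.lookup (power_sum n m) e" .
  qed
  moreover have "power_sum n m \<in> polys_in n"
    unfolding polys_in_def by (auto dest!: keys split: if_splits)
  moreover have "homogeneous m (power_sum n m)"
    unfolding homogeneous_def monom_degree_def by (auto dest!: keys)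
  ultimately show ?thesis
    by (simp add: hom_sym_polys_def sym_polys_def)
qed

lemma power_sum_in_sym_polys_le: "power_sum n m \<in> sym_polys_le n m"
proof -
  define q where "q k = (if k = m then power_sum n m else 0)" for k
  \<comment> \<open>With no keys, zero is homogeneous of every degree, so it can fill the components
    other than \<open>m\<close>.\<close>
  have "(0 :: cpoly) \<in> hom_sym_polys n k" for k
    by (auto simp: hom_sym_polys_def sym_polys_def polys_in_def homogeneous_def
        intro!: poly_mapping_eqI simp: lookup_permute_vars)
  then have "\<forall>k\<le>m. q k \<in> hom_sym_polys n k"
    by (simp add: q_def power_sum_hom_sym)
  moreover have "power_sum n m = (\<Sum>k\<le>m. q k)"
    by (simp add: q_def)
  ultimately show ?thesis
    unfolding sym_polys_le_def by blast
qed

section \<open>Growth of symmetric polynomials of bounded degree\<close>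

text \<open>A key of the sum is a key of some homogeneous summand of degree
  \<open>k \<le> m\<close>, and a single exponent is at most the total degree.\<close>

lemma sym_polys_le_keys:
  assumes "p \<in> sym_polys_le n m" "e \<in> Poly_Mapping.keys p"
  shows "Poly_Mapping.keys e \<subseteq> {..<n}" "Poly_Mapping.lookup e i \<le> m"
proof -
  obtain q where p: "p = (\<Sum>k\<le>m. q k)" and q: "\<forall>k\<le>m. q k \<in> hom_sym_polys n k"
    using assms unfolding sym_polys_le_def by blast
  from assms(2) have "e \<in> (\<Union>k\<in>{..m}. Poly_Mapping.keys (q k))"
    unfolding p by (rule subsetD[OF Poly_Mapping.keys_sum])
  then obtain k where k: "k \<le> m" "e \<in> Poly_Mapping.keys (q k)" by auto
  with q have deg: "monom_degree e = k" and "Poly_Mapping.keys e \<subseteq> {..<n}"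
    by (auto simp: hom_sym_polys_def sym_polys_def polys_in_def homogeneous_def)
  then show "Poly_Mapping.keys e \<subseteq> {..<n}" by simp
  show "Poly_Mapping.lookup e i \<le> m"
  proof (cases "i \<in> Poly_Mapping.keys e")
    case True
    then have "Poly_Mapping.lookup e i \<le> monom_degree e"
      unfolding monom_degree_def by (intro member_le_sum) auto
    with deg k show ?thesis by simp
  qed (simp add: in_keys_iff)
qed

text \<open>The base \<open>1 + x i\<close> is at least 1, so every exponent can be raised to
  \<open>m\<close>; all monomials then share one bound of product form.\<close>

lemma norm_poly_fun_le:
  assumes p: "p \<in> sym_polys_le n m" and x: "\<And>i. i < n \<Longrightarrow> 0 \<le> x i"
  shows "norm (poly_fun p x) \<le>
    (\<Sum>e\<in>Poly_Mapping.keys p. norm (Poly_Mapping.lookup p e)) * (\<Prod>i<n. (1 + x i) ^ m)"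
proof -
  have mono: "(\<Prod>i\<in>Poly_Mapping.keys e. \<bar>x i\<bar> ^ Poly_Mapping.lookup e i) \<le> (\<Prod>i<n. (1 + x i) ^ m)"
    if e: "e \<in> Poly_Mapping.keys p" for e
  proof -
    have "(\<Prod>i\<in>Poly_Mapping.keys e. \<bar>x i\<bar> ^ Poly_Mapping.lookup e i)
        = (\<Prod>i<n. \<bar>x i\<bar> ^ Poly_Mapping.lookup e i)"
      using sym_polys_le_keys(1)[OF p e]
      by (intro prod.mono_neutral_left) (auto simp: in_keys_iff)
    also have "\<dots> \<le> (\<Prod>i<n. (1 + x i) ^ m)"
    proof (intro prod_mono conjI)
      fix i assume "i \<in> {..<n}"
      then have i: "0 \<le> x i" using x by simp
      have "\<bar>x i\<bar> ^ Poly_Mapping.lookup e i \<le> (1 + x i) ^ Poly_Mapping.lookup e i"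
        using i by (intro power_mono) auto
      also have "\<dots> \<le> (1 + x i) ^ m"
        using i sym_polys_le_keys(2)[OF p e] by (intro power_increasing) auto
      finally show "\<bar>x i\<bar> ^ Poly_Mapping.lookup e i \<le> (1 + x i) ^ m" .
    qed simp
    finally show ?thesis .
  qed
  have "norm (poly_fun p x) \<le> (\<Sum>e\<in>Poly_Mapping.keys p. norm (Poly_Mapping.lookup p e) *
      (\<Prod>i\<in>Poly_Mapping.keys e. \<bar>x i\<bar> ^ Poly_Mapping.lookup e i))"
    unfolding poly_fun_def poly_eval_def
    by (rule order_trans[OF norm_sum]) (simp add: norm_mult norm_power flip: prod_norm)
  also have "\<dots> \<le> (\<Sum>e\<in>Poly_Mapping.keys p. norm (Poly_Mapping.lookup p e) * (\<Prod>i<n. (1 + x i) ^ m))"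
    by (intro sum_mono mult_left_mono mono) auto
  finally show ?thesis by (simp add: sum_distrib_right)
qed

section \<open>Measurability and membership in the weighted L^2 space\<close>

abbreviation lborel_half :: "real measure" where
  "lborel_half \<equiv> restrict_space lborel {0<..}"

text \<open>Sigma-finiteness of the half-line measure makes integrals of products of one-variable
  functions factorise.\<close>

interpretation half: product_sigma_finite "\<lambda>_::nat. lborel_half"
  by (intro product_sigma_finite.intro sigma_finite_measure_restrict_space sigma_finite_lborel) simp

lemma measurable_coordinate:
  "i < n \<Longrightarrow> (\<lambda>x. x i) \<in> borel_measurable (lborel_pos n)"
proof -
  assume "i < n"
  then have "(\<lambda>x. x i) \<in> lborel_pos n \<rightarrow>\<^sub>M lborel_half"
    unfolding lborel_pos_def by (intro measurable_component_singleton) simp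
  moreover have "(\<lambda>t. t) \<in> borel_measurable lborel_half"
    by (intro measurable_restrict_space1) simp
  ultimately show ?thesis by (rule measurable_compose)
qed

lemma measurable_bessel_density:
  "bessel_density n a \<kappa> \<in> borel_measurable (lborel_pos n)"
proof -
  note measurable_coordinate [measurable]
  have "(\<lambda>x. (\<Prod>i<n. x i powr (a - 2) * exp (- 2 / x i)) *
     (\<Prod>j<n. \<Prod>i<j. \<bar>x i - x j\<bar> powr (2 * \<kappa>))) \<in> borel_measurable (lborel_pos n)"
    by (intro borel_measurable_times borel_measurable_prod) measurable
  then show ?thesis unfolding bessel_density_def .
qed

lemma measurable_poly_fun:
  assumes "p \<in> sym_polys_le n m"
  shows "poly_fun p \<in> borel_measurable (lborel_pos n)"
proof -
  have "(\<lambda>x. \<Sum>e\<in>Poly_Mapping.keys p. Poly_Mapping.lookup p e *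
      (\<Prod>i\<in>Poly_Mapping.keys e. complex_of_real (x i) ^ Poly_Mapping.lookup e i))
      \<in> borel_measurable (lborel_pos n)"
    using sym_polys_le_keys(1)[OF assms]
    by (intro borel_measurable_sum borel_measurable_times borel_measurable_prod borel_measurable_power
        borel_measurable_const measurable_compose[OF _ borel_measurable_of_real] measurable_coordinate) blast
  then show ?thesis unfolding poly_fun_def poly_eval_def .
qed

lemma bessel_density_nonneg: "0 \<le> bessel_density n a \<kappa> x"
  unfolding bessel_density_def by (intro mult_nonneg_nonneg prod_nonneg) auto

text \<open>Both directions of the theorem work with Lebesgue measure, so the density is moved into
  the integrand.\<close>

lemma L2_bessel_iff:
  assumes "p \<in> sym_polys_le n m"
  shows "poly_fun p \<in> L2_space (bessel_measure n a \<kappa>) \<longleftrightarrow>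
    integrable (lborel_pos n) (\<lambda>x. bessel_density n a \<kappa> x * (norm (poly_fun p x))\<^sup>2)"
proof -
  have meas: "poly_fun p \<in> borel_measurable (lborel_pos n)"
    by (rule measurable_poly_fun[OF assms])
  then have "integrable (density (lborel_pos n) (bessel_density n a \<kappa>)) (\<lambda>x. (norm (poly_fun p x))\<^sup>2) \<longleftrightarrow>
      integrable (lborel_pos n) (\<lambda>x. bessel_density n a \<kappa> x *\<^sub>R (norm (poly_fun p x))\<^sup>2)"
    by (intro integrable_density borel_measurable_power borel_measurable_norm)
      (simp_all add: bessel_density_nonneg measurable_bessel_density)
  with meas show ?thesis
    by (simp add: L2_space_def bessel_measure_def)
qed

section \<open>The one-dimensional dominating integral\<close>

text \<open>A single term of the exponential series, whose terms are all nonnegative, is at most its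
  sum.\<close>

lemma power_le_fact_mult_exp:
  fixes x :: real
  assumes "0 \<le> x"
  shows "x ^ N \<le> fact N * exp x"
proof -
  have "(\<Sum>n\<in>{N}. x ^ n /\<^sub>R fact n) \<le> exp x"
    unfolding sums_unique[OF exp_converges[of x]]
    using assms by (intro sum_le_suminf sums_summable[OF exp_converges]) auto
  then show ?thesis by (simp add: field_simps)
qed

text \<open>With \<open>u = 1 / t \<ge> 1\<close> the left side is
  \<open>u powr b * exp (- 2 * u)\<close>. One factor \<open>exp (- u)\<close> absorbs the power and
  the other is at most 1.\<close>

lemma bessel_weight_le_fact:
  fixes t b :: real
  assumes t: "0 < t" "t \<le> 1" and N: "b \<le> real N"
  shows "t powr (- b) * exp (- 2 / t) \<le> fact N"
proof -
  have u: "1 \<le> 1 / t" using t by simp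
  have "t powr (- b) = (1 / t) powr b"
    using t by (simp add: powr_divide powr_minus_divide)
  also have "\<dots> \<le> (1 / t) ^ N"
    using powr_mono[OF N u] t by (simp add: powr_realpow)
  also have "\<dots> \<le> fact N * exp (1 / t)"
    using t by (intro power_le_fact_mult_exp) simp
  finally have "t powr (- b) * exp (- 2 / t) \<le> fact N * exp (1 / t) * exp (- 2 / t)"
    by (intro mult_right_mono) auto
  also have "\<dots> = fact N * exp (- 1 / t)"
    by (simp add: mult.assoc flip: exp_add)
  also have "\<dots> \<le> fact N * 1"
    using t by (intro mult_left_mono) auto
  finally show ?thesis by simp
qed

lemma integrable_powr_atLeast:
  fixes s :: real
  assumes "s < - 1"
  shows "integrable lborel (\<lambda>t. t powr s * indicator {1..} t)"
proof -
  have "((\<lambda>t. t powr (s + 1) / (s + 1)) \<longlongrightarrow> 0 / (s + 1)) at_top"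
    using assms by (intro tendsto_intros tendsto_neg_powr filterlim_ident) auto
  then have "(\<integral>\<^sup>+t. ennreal (t powr s) * indicator {1..} t \<partial>lborel) = ennreal (0 - 1 powr (s + 1) / (s + 1))"
    using assms
    by (intro nn_integral_FTC_atLeast) (auto intro!: derivative_eq_intros)
  moreover have "ennreal (t powr s) * indicator {1..} t = ennreal (t powr s * indicator {1..} t)" for t
    by (simp split: split_indicator)
  ultimately show ?thesis
    by (intro integrableI_nonneg) auto
qed

text \<open>Near 0 the exponential tames any power; at infinity the exponent is
  \<open>a - 2 + M < - 1\<close>.\<close>

lemma integrable_bessel_weight:
  fixes a M :: real
  assumes M: "0 \<le> M" and aM: "a + M < 1"
  shows "integrable lborel_half (\<lambda>t. t powr (a - 2) * exp (- 2 / t) * (1 + t) powr M)"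
proof -
  obtain N :: nat where N: "2 - a \<le> real N" using real_arch_simple by blast
  \<comment> \<open>The factor \<open>2 powr M\<close> serves both pieces:
    \<open>1 + t \<le> 2\<close> up to 1 and \<open>1 + t \<le> 2 * t\<close> beyond. The overlap at
    1 is harmless in an upper bound.\<close>
  define h where "h t = 2 powr M * (fact N * indicator {0..1} t + t powr (a - 2 + M) * indicator {1..} t)"
    for t :: real
  have "integrable lborel h"
    unfolding h_def using aM
    by (intro integrable_mult_right Bochner_Integration.integrable_add integrable_powr_atLeast) auto
  then have "integrable lborel (\<lambda>t. indicator {0<..} t *\<^sub>R (t powr (a - 2) * exp (- 2 / t) * (1 + t) powr M))"
  proof (rule Bochner_Integration.integrable_bound, goal_cases)
    case 1
    show ?case by measurable
  next
    case 2
    have "norm (indicator {0<..} t *\<^sub>R (t powr (a - 2) * exp (- 2 / t) * (1 + t) powr M)) \<le> norm (h t)" for t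
    proof -
      consider "t \<le> 0" | "0 < t" "t \<le> 1" | "1 < t" by linarith
      then show ?thesis
      proof cases
        case 1
        then show ?thesis by simp
      next
        case 2
        have "t powr (a - 2) * exp (- 2 / t) * (1 + t) powr M \<le> fact N * 2 powr M"
          using 2 M bessel_weight_le_fact[OF 2 N] by (intro mult_mono powr_mono2) auto
        also have "\<dots> \<le> h t"
          using 2 by (simp add: h_def)
        finally show ?thesis using 2 by simp
      next
        case 3
        have "(1 + t) powr M \<le> (2 * t) powr M"
          using 3 M by (intro powr_mono2) auto
        then have "t powr (a - 2) * exp (- 2 / t) * (1 + t) powr M \<le> t powr (a - 2) * 1 * (2 * t) powr M"
          using 3 by (intro mult_mono) auto
        also have "\<dots> = h t"
          using 3 by (simp add: h_def powr_mult powr_add)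
        finally show ?thesis using 3 by simp
      qed
    qed
    then show ?case by (rule AE_I2)
  qed
  then show ?thesis
    by (simp add: integrable_restrict_space)
qed

section \<open>Domination by a product and sufficiency\<close>

text \<open>Each index lies in exactly \<open>n - 1\<close> of the pairs. In the induction the new
  index meets every old one once, which raises the old exponents by 1 and gives \<open>u n\<close>
  the exponent \<open>n\<close>.\<close>

lemma prod_pairs:
  fixes u :: "nat \<Rightarrow> 'a::comm_monoid_mult"
  shows "(\<Prod>j<n. \<Prod>i<j. u i * u j) = (\<Prod>i<n. u i ^ (n - 1))"
proof (induction n)
  case (Suc n)
  \<comment> \<open>A factor exists only if \<open>n > 0\<close>, so the truncated
    \<open>n - 1\<close> causes no trouble.\<close>
  have "(\<Prod>i<n. u i ^ (n - 1)) * (\<Prod>i<n. u i) = (\<Prod>i<n. u i ^ n)"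
    unfolding prod.distrib[symmetric]
    by (intro prod.cong refl) (auto simp flip: power_Suc2)
  moreover have "(\<Prod>i<n. u i * u n) = (\<Prod>i<n. u i) * u n ^ n"
    by (simp add: prod.distrib)
  ultimately show ?case
    using Suc by (simp add: mult.assoc[symmetric])
qed simp

lemma bessel_density_le:
  assumes \<kappa>: "\<kappa> \<ge> 0" and x: "\<And>i. i < n \<Longrightarrow> 0 < x i"
  shows "bessel_density n a \<kappa> x \<le>
    (\<Prod>i<n. x i powr (a - 2) * exp (- 2 / x i) * (1 + x i) powr (2 * \<kappa> * real (n - 1)))"
proof -
  have "(\<Prod>j<n. \<Prod>i<j. \<bar>x i - x j\<bar> powr (2 * \<kappa>))
      \<le> (\<Prod>j<n. \<Prod>i<j. (1 + x i) powr (2 * \<kappa>) * (1 + x j) powr (2 * \<kappa>))"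
  proof (intro prod_mono conjI prod_nonneg ballI)
    fix i j assume "j \<in> {..<n}" "i \<in> {..<j}"
    then have pos: "0 < x i" "0 < x j" using x by auto
    \<comment> \<open>The product expands to \<open>1 + x i + x j + x i * x j\<close>, which exceeds
      either coordinate.\<close>
    then have "\<bar>x i - x j\<bar> \<le> (1 + x i) * (1 + x j)"
      using mult_pos_pos[OF pos] by (simp add: algebra_simps abs_le_iff)
    then show "\<bar>x i - x j\<bar> powr (2 * \<kappa>) \<le> (1 + x i) powr (2 * \<kappa>) * (1 + x j) powr (2 * \<kappa>)"
      using \<kappa> pos by (subst powr_mult[symmetric]) (auto intro!: powr_mono2)
  qed auto
  also have "\<dots> = (\<Prod>i<n. (1 + x i) powr (2 * \<kappa> * real (n - 1)))"
    unfolding prod_pairs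
  proof (intro prod.cong refl)
    fix i assume "i \<in> {..<n}"
    then have "1 + x i \<noteq> 0" using x[of i] by auto
    then show "((1 + x i) powr (2 * \<kappa>)) ^ (n - 1) = (1 + x i) powr (2 * \<kappa> * real (n - 1))"
      by (simp add: powr_power mult.commute mult.left_commute)
  qed
  finally show ?thesis
    unfolding bessel_density_def prod.distrib
    by (intro mult_left_mono) (auto intro!: mult_nonneg_nonneg prod_nonneg)
qed

lemma space_lborel_pos: "x \<in> space (lborel_pos n) \<Longrightarrow> i < n \<Longrightarrow> 0 < x i"
  by (auto simp: lborel_pos_def space_PiM space_restrict_space)

lemma integrable_poly_bessel:
  assumes \<kappa>: "\<kappa> \<ge> 0" and a: "a < - 2 * (real m + \<kappa> * real (n - 1)) + 1"
    and p: "p \<in> sym_polys_le n m"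
  shows "integrable (lborel_pos n) (\<lambda>x. bessel_density n a \<kappa> x * (norm (poly_fun p x))\<^sup>2)"
proof -
  \<comment> \<open>The squared polynomial contributes \<open>2 * m\<close> and the pair differences
    \<open>2 * \<kappa> * (n - 1)\<close>; the hypothesis on \<open>a\<close> says precisely that
    \<open>a + M < 1\<close>.\<close>
  define M where "M = 2 * real m + 2 * \<kappa> * real (n - 1)"
  define g where "g t = t powr (a - 2) * exp (- 2 / t) * (1 + t) powr M" for t :: real
  define C where "C = (\<Sum>e\<in>Poly_Mapping.keys p. norm (Poly_Mapping.lookup p e))"
  note [measurable] = measurable_poly_fun[OF p] measurable_bessel_density
  have "integrable lborel_half g"
    unfolding g_def using \<kappa> a by (intro integrable_bessel_weight) (auto simp: M_def algebra_simps)
  then have "integrable (lborel_pos n) (\<lambda>x. C\<^sup>2 * (\<Prod>i<n. g (x i)))"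
    unfolding lborel_pos_def by (intro integrable_mult_right half.product_integrable_prod) auto
  then show ?thesis
  proof (rule Bochner_Integration.integrable_bound)
    show "AE x in lborel_pos n. norm (bessel_density n a \<kappa> x * (norm (poly_fun p x))\<^sup>2)
        \<le> norm (C\<^sup>2 * (\<Prod>i<n. g (x i)))"
    proof (rule AE_I2)
      fix x assume "x \<in> space (lborel_pos n)"
      then have pos: "0 < x i" if "i < n" for i using that by (rule space_lborel_pos)
      have "(norm (poly_fun p x))\<^sup>2 \<le> (C * (\<Prod>i<n. (1 + x i) ^ m))\<^sup>2"
        unfolding C_def using pos by (intro power_mono norm_poly_fun_le[OF p]) (auto intro: less_imp_le)
      also have "\<dots> = C\<^sup>2 * (\<Prod>i<n. (1 + x i) powr (2 * real m))"
      proof -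
        have "((1 + x i) ^ m)\<^sup>2 = (1 + x i) powr (2 * real m)" if "i < n" for i
          using pos[OF that] powr_realpow[of "1 + x i" "m * 2"]
          by (simp add: power_mult[symmetric] mult.commute)
        then show ?thesis by (simp add: power_mult_distrib prod_power_distrib)
      qed
      finally have "bessel_density n a \<kappa> x * (norm (poly_fun p x))\<^sup>2 \<le>
          (\<Prod>i<n. x i powr (a - 2) * exp (- 2 / x i) * (1 + x i) powr (2 * \<kappa> * real (n - 1))) *
          (C\<^sup>2 * (\<Prod>i<n. (1 + x i) powr (2 * real m)))"
        by (intro mult_mono bessel_density_le \<kappa> pos prod_nonneg) auto
      also have "\<dots> = C\<^sup>2 * (\<Prod>i<n. g (x i))"
        by (simp add: g_def M_def powr_add prod.distrib)
      finally show "norm (bessel_density n a \<kappa> x * (norm (poly_fun p x))\<^sup>2)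
          \<le> norm (C\<^sup>2 * (\<Prod>i<n. g (x i)))"
        using bessel_density_nonneg[of n a \<kappa> x] by simp
    qed
  qed measurable
qed

section \<open>Divergence and necessity\<close>

lemma nn_integral_inverse_atLeast:
  fixes A :: real
  assumes "A > 0"
  shows "(\<integral>\<^sup>+t. ennreal (1 / t) * indicator {A..} t \<partial>lborel) = \<infinity>"
proof (rule ccontr)
  assume "\<not> ?thesis"
  then obtain r where r: "(\<integral>\<^sup>+t. ennreal (1 / t) * indicator {A..} t \<partial>lborel) = ennreal r" "0 \<le> r"
    by (cases "\<integral>\<^sup>+t. ennreal (1 / t) * indicator {A..} t \<partial>lborel") auto
  \<comment> \<open>Chosen so that the integral up to \<open>B\<close> is already
    \<open>r + 1\<close>, above the supposed total \<open>r\<close>.\<close>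
  define B where "B = A * exp (r + 1)"
  have "A \<le> B" unfolding B_def using assms r by simp
  have "(\<integral>\<^sup>+t. ennreal (1 / t) * indicator {A..B} t \<partial>lborel) = ennreal (ln B - ln A)"
    using assms \<open>A \<le> B\<close>
    by (intro nn_integral_FTC_Icc) (auto intro!: derivative_eq_intros simp: field_simps)
  also have "ln B - ln A = r + 1"
    using assms by (simp add: B_def ln_mult)
  finally have "ennreal (r + 1) = (\<integral>\<^sup>+t. ennreal (1 / t) * indicator {A..B} t \<partial>lborel)" ..
  also have "\<dots> \<le> ennreal r"
    unfolding r(1)[symmetric] by (intro nn_integral_mono) (auto split: split_indicator)
  finally have "ennreal (r + 1) \<le> ennreal r" .
  then show False using r by simp
qed

text \<open>The box makes every factor easy to bound: all coordinates are at least 1, so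
  \<open>exp (- 2 / x i) \<ge> exp (- 2)\<close>; the first \<open>k\<close> are at least 1 apart;
  and the last is at least twice any other.\<close>

lemma bessel_density_Suc_ge:
  fixes x :: "nat \<Rightarrow> real"
  assumes \<kappa>: "\<kappa> \<ge> 0" and x: "\<And>i. i < k \<Longrightarrow> x i \<in> {2 * real i + 1 .. 2 * real i + 2}"
    and xk: "x k \<ge> 4 * real k + 4"
  shows "(\<Prod>i<k. exp (- 2) * (2 * real i + 2) powr (- \<bar>a - 2\<bar>)) *
      (exp (- 2) * x k powr (a - 2)) * (x k / 2) powr (2 * \<kappa> * real k)
    \<le> bessel_density (Suc k) a \<kappa> x"
proof -
  have exp_ge: "exp (- 2) \<le> exp (- 2 / t)" if "1 \<le> t" for t :: real
    using that by (simp add: field_simps)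
  have "(\<Prod>i<k. exp (- 2) * (2 * real i + 2) powr (- \<bar>a - 2\<bar>))
      \<le> (\<Prod>i<k. x i powr (a - 2) * exp (- 2 / x i))"
  proof (intro prod_mono conjI)
    fix i assume "i \<in> {..<k}"
    then have i: "1 \<le> x i" "x i \<le> 2 * real i + 2" using x[of i] by auto
    \<comment> \<open>The exponent \<open>- \<bar>a - 2\<bar>\<close> handles both signs of
      \<open>a - 2\<close> at once, since the base is at least 1.\<close>
    have "(2 * real i + 2) powr (- \<bar>a - 2\<bar>) \<le> x i powr (- \<bar>a - 2\<bar>)"
      using i by (intro powr_mono2') auto
    also have "\<dots> \<le> x i powr (a - 2)"
      using i by (intro powr_mono) auto
    finally show "exp (- 2) * (2 * real i + 2) powr (- \<bar>a - 2\<bar>) \<le> x i powr (a - 2) * exp (- 2 / x i)"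
      using exp_ge[OF i(1)] by (subst mult.commute) (intro mult_mono, auto)
  qed simp
  moreover have "exp (- 2) * x k powr (a - 2) \<le> x k powr (a - 2) * exp (- 2 / x k)"
    using exp_ge[of "x k"] xk by (subst mult.commute) (intro mult_left_mono, auto)
  ultimately have weight: "(\<Prod>i<k. exp (- 2) * (2 * real i + 2) powr (- \<bar>a - 2\<bar>)) *
      (exp (- 2) * x k powr (a - 2)) \<le> (\<Prod>i<Suc k. x i powr (a - 2) * exp (- 2 / x i))"
    unfolding prod.lessThan_Suc by (rule mult_mono) (auto intro!: prod_nonneg)
  have "1 \<le> (\<Prod>j<k. \<Prod>i<j. \<bar>x i - x j\<bar> powr (2 * \<kappa>))"
  proof (intro prod_ge_1)
    fix i j assume "j \<in> {..<k}" "i \<in> {..<j}"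
    then have "1 \<le> \<bar>x i - x j\<bar>" using x[of i] x[of j] by auto
    then show "1 \<le> \<bar>x i - x j\<bar> powr (2 * \<kappa>)" using \<kappa> by (intro ge_one_powr_ge_zero) auto
  qed
  moreover have "(x k / 2) powr (2 * \<kappa> * real k) \<le> (\<Prod>i<k. \<bar>x i - x k\<bar> powr (2 * \<kappa>))"
  proof -
    have "(\<Prod>i<k. (x k / 2) powr (2 * \<kappa>)) \<le> (\<Prod>i<k. \<bar>x i - x k\<bar> powr (2 * \<kappa>))"
    proof (intro prod_mono conjI powr_mono2)
      fix i assume "i \<in> {..<k}"
      \<comment> \<open>The other coordinates are at most \<open>2 * k\<close>, hence below
        \<open>x k / 2\<close>.\<close>
      then show "x k / 2 \<le> \<bar>x i - x k\<bar>" using x[of i] xk by auto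
    qed (use \<kappa> xk in auto)
    then show ?thesis using xk by (simp add: powr_power mult.commute mult.left_commute)
  qed
  ultimately have "1 * (x k / 2) powr (2 * \<kappa> * real k) \<le> (\<Prod>j<Suc k. \<Prod>i<j. \<bar>x i - x j\<bar> powr (2 * \<kappa>))"
    unfolding prod.lessThan_Suc[of _ k] by (intro mult_mono) (auto intro!: prod_nonneg)
  with weight show ?thesis
    unfolding bessel_density_def
    by (intro mult_mono) (auto intro!: prod_nonneg mult_nonneg_nonneg)
qed

text \<open>Here \<open>k\<close> is the number of variables minus one. The integrand has a minorant
  of product form whose first \<open>k\<close> factors have positive finite integrals, while the
  last behaves like \<open>1 / t\<close> at infinity.\<close>

lemma not_integrable_power_sum_bessel:
  assumes \<kappa>: "\<kappa> \<ge> 0" and a: "a \<ge> - 2 * (real m + \<kappa> * real k) + 1"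
  shows "\<not> integrable (lborel_pos (Suc k))
    (\<lambda>x. bessel_density (Suc k) a \<kappa> x * (norm (poly_fun (power_sum (Suc k) m) x))\<^sup>2)"
    (is "\<not> integrable _ ?F")
proof
  assume F: "integrable (lborel_pos (Suc k)) ?F"
  \<comment> \<open>The constants of the lower bound for the density; the power of 2 in the last one
    comes from \<open>x k / 2\<close>.\<close>
  define c where "c i = (if i < k then exp (- 2) * (2 * real i + 2) powr (- \<bar>a - 2\<bar>)
      else exp (- 2) * 2 powr (- (2 * \<kappa> * real k)))" for i
  define I where "I i = (if i < k then {2 * real i + 1 .. 2 * real i + 2} else {4 * real k + 4 ..})" for i
  define g where "g i t = c i * (if i < k then 1 else 1 / t) * indicator (I i) t" for i t
  have c: "0 < c i" for i by (simp add: c_def)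
  have I: "I i \<subseteq> {0<..}" for i by (auto simp: I_def)
  have g_nonneg: "0 \<le> g i t" for i t
    using c[of i] I[of i] by (auto simp: g_def split: split_indicator)
  have g_meas [measurable]: "g i \<in> borel_measurable borel" for i
    unfolding g_def I_def by measurable
  have le: "(\<Prod>i<Suc k. g i (x i)) \<le> ?F x" for x
  proof (cases "\<forall>i<Suc k. x i \<in> I i")
    case True
    then have x: "\<And>i. i < k \<Longrightarrow> x i \<in> {2 * real i + 1 .. 2 * real i + 2}"
      and xk: "x k \<ge> 4 * real k + 4"
      by (auto simp: I_def less_Suc_eq split: if_splits)
    have "(\<Prod>i<Suc k. g i (x i)) = (\<Prod>i<k. c i) * (c k * (1 / x k))"
    proof -
      have "g i (x i) = c i" if "i < k" for i
        using that True by (simp add: g_def)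
      moreover have "g k (x k) = c k * (1 / x k)"
        using True by (simp add: g_def)
      ultimately show ?thesis by simp
    qed
    also have "\<dots> \<le> (\<Prod>i<k. c i) * (c k * (x k powr (a - 2) * x k powr (2 * \<kappa> * real k) * x k powr (2 * real m)))"
    proof -
      have "1 / x k = x k powr (- 1)" using xk by (simp add: powr_minus_divide)
      \<comment> \<open>The hypothesis on \<open>a\<close> says that this exponent is at least
        \<open>- 1\<close>, and \<open>x k \<ge> 1\<close>.\<close>
      also have "\<dots> \<le> x k powr (a - 2 + 2 * \<kappa> * real k + 2 * real m)"
        using xk a by (intro powr_mono) (auto simp: algebra_simps)
      finally have "1 / x k \<le> x k powr (a - 2) * x k powr (2 * \<kappa> * real k) * x k powr (2 * real m)"
        by (simp only: powr_add)
      then show ?thesis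
        using c by (intro mult_left_mono prod_nonneg) (auto intro: less_imp_le)
    qed
    also have "\<dots> = (\<Prod>i<k. exp (- 2) * (2 * real i + 2) powr (- \<bar>a - 2\<bar>)) *
      (exp (- 2) * x k powr (a - 2)) * (x k / 2) powr (2 * \<kappa> * real k) * x k powr (2 * real m)"
    proof -
      have "(x k / 2) powr (2 * \<kappa> * real k) = 2 powr (- (2 * \<kappa> * real k)) * x k powr (2 * \<kappa> * real k)"
        using xk by (simp add: powr_divide powr_minus_divide)
      moreover have "(\<Prod>i<k. c i) = (\<Prod>i<k. exp (- 2) * (2 * real i + 2) powr (- \<bar>a - 2\<bar>))"
        by (intro prod.cong) (simp_all add: c_def)
      moreover have "c k = exp (- 2) * 2 powr (- (2 * \<kappa> * real k))"
        by (simp add: c_def)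
      ultimately show ?thesis by (simp only: mult_ac)
    qed
    also have "\<dots> \<le> ?F x"
    proof (intro mult_mono bessel_density_Suc_ge \<kappa> x xk)
      \<comment> \<open>The other terms of the power sum are nonnegative, so it is at least its last
        term.\<close>
      have "0 \<le> x i" if "i < k" for i using x[OF that] by auto
      then have "x k ^ m \<le> (\<Sum>i<Suc k. x i ^ m)"
        by (auto intro!: sum_nonneg)
      then have "(x k ^ m)\<^sup>2 \<le> (norm (poly_fun (power_sum (Suc k) m) x))\<^sup>2"
        unfolding poly_fun_power_sum norm_of_real using xk by (intro power_mono) auto
      moreover have "x k powr (2 * real m) = (x k ^ m)\<^sup>2"
        using xk powr_realpow[of "x k" "m * 2"] by (simp add: power_mult[symmetric] mult.commute)
      ultimately show "x k powr (2 * real m) \<le> (norm (poly_fun (power_sum (Suc k) m) x))\<^sup>2" by simp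
    qed (auto simp: bessel_density_nonneg)
    finally show ?thesis .
  next
    \<comment> \<open>Outside the box a factor of the minorant vanishes, and the integrand is
      nonnegative everywhere.\<close>
    case False
    then obtain i where "i < Suc k" "x i \<notin> I i"
      by blast
    then have "i < Suc k" "g i (x i) = 0"
      by (simp_all add: g_def)
    then have "(\<Prod>i<Suc k. g i (x i)) = 0"
      by (intro prod_zero) auto
    moreover have "0 \<le> ?F x"
      by (simp add: bessel_density_nonneg)
    ultimately show ?thesis by (simp only:)
  qed
  have half_eq: "(\<integral>\<^sup>+t. ennreal (g i t) \<partial>lborel_half) =
      ennreal (c i) * (\<integral>\<^sup>+t. ennreal (if i < k then 1 else 1 / t) * indicator (I i) t \<partial>lborel)" for i
  proof -
    have "(\<integral>\<^sup>+t. ennreal (g i t) \<partial>lborel_half) = (\<integral>\<^sup>+t. ennreal (g i t) * indicator {0<..} t \<partial>lborel)"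
      by (intro nn_integral_restrict_space) auto
    also have "\<dots> = (\<integral>\<^sup>+t. ennreal (c i) * (ennreal (if i < k then 1 else 1 / t) * indicator (I i) t) \<partial>lborel)"
      using c[of i] I[of i]
      by (intro nn_integral_cong) (auto simp: g_def ennreal_mult[symmetric] split: split_indicator)
    also have "\<dots> = ennreal (c i) * (\<integral>\<^sup>+t. ennreal (if i < k then 1 else 1 / t) * indicator (I i) t \<partial>lborel)"
      by (intro nn_integral_cmult) (auto simp: I_def)
    finally show ?thesis .
  qed
  \<comment> \<open>Each of these intervals has length 1.\<close>
  have bounded: "(\<integral>\<^sup>+t. ennreal (g i t) \<partial>lborel_half) = ennreal (c i)" if "i < k" for i
    using that by (simp add: half_eq I_def)
  have unbounded: "(\<integral>\<^sup>+t. ennreal (g k t) \<partial>lborel_half) = \<infinity>"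
    using c[of k] by (simp add: half_eq I_def nn_integral_inverse_atLeast ennreal_mult_top)
  have "(\<integral>\<^sup>+x. ennreal (\<Prod>i<Suc k. g i (x i)) \<partial>lborel_pos (Suc k))
      = (\<integral>\<^sup>+x. (\<Prod>i<Suc k. ennreal (g i (x i))) \<partial>lborel_pos (Suc k))"
    by (simp add: prod_ennreal g_nonneg del: prod.lessThan_Suc)
  also have "\<dots> = (\<Prod>i<Suc k. \<integral>\<^sup>+t. ennreal (g i t) \<partial>lborel_half)"
    unfolding lborel_pos_def
    by (intro half.product_nn_integral_prod) (auto intro!: measurable_restrict_space1)
  also have "\<dots> = (\<Prod>i<k. ennreal (c i)) * \<infinity>"
    by (simp add: bounded unbounded)
  also have "\<dots> = \<infinity>"
  proof -
    \<comment> \<open>Strict positivity is essential, because \<open>0 * \<infinity> = 0\<close> in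
      \<open>ennreal\<close>.\<close>
    have "0 < (\<Prod>i<k. c i)"
      using c by (intro prod_pos) simp
    then have "ennreal (\<Prod>i<k. c i) * \<infinity> = \<infinity>"
      by (metis ennreal_mult_top ennreal_eq_0_iff infinity_ennreal_def not_less)
    then show ?thesis
      using c by (simp only: prod_ennreal less_imp_le)
  qed
  finally have "(\<integral>\<^sup>+x. ennreal (\<Prod>i<Suc k. g i (x i)) \<partial>lborel_pos (Suc k)) = \<infinity>" .
  moreover have "(\<integral>\<^sup>+x. ennreal (\<Prod>i<Suc k. g i (x i)) \<partial>lborel_pos (Suc k))
      \<le> (\<integral>\<^sup>+x. ennreal (norm (?F x)) \<partial>lborel_pos (Suc k))"
    by (intro nn_integral_mono ennreal_leI order_trans[OF le]) simp
  ultimately show False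
    using F by (simp add: integrable_iff_bounded top_unique)
qed

theorem lemma7p1:
  fixes n m :: nat and a \<kappa> :: real
  assumes "n \<ge> 1" and "\<kappa> \<ge> 0"
  shows "poly_fun ` sym_polys_le n m \<subseteq> L2_space (bessel_measure n a \<kappa>) \<longleftrightarrow>
    a < - 2 * (real m + \<kappa> * (real n - 1)) + 1"
proof -
  \<comment> \<open>With \<open>n = Suc k\<close> the real difference \<open>real n - 1\<close> and
    the truncated \<open>n - 1\<close> both become \<open>k\<close>.\<close>
  obtain k where n: "n = Suc k"
    using assms(1) by (cases n) auto
  show ?thesis
  proof
    assume "poly_fun ` sym_polys_le n m \<subseteq> L2_space (bessel_measure n a \<kappa>)"
    then have "poly_fun (power_sum n m) \<in> L2_space (bessel_measure n a \<kappa>)"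
      using power_sum_in_sym_polys_le by blast
    then show "a < - 2 * (real m + \<kappa> * (real n - 1)) + 1"
      using not_integrable_power_sum_bessel[OF assms(2), of m k a]
      by (force simp: L2_bessel_iff[OF power_sum_in_sym_polys_le] n)
  next
    assume "a < - 2 * (real m + \<kappa> * (real n - 1)) + 1"
    then show "poly_fun ` sym_polys_le n m \<subseteq> L2_space (bessel_measure n a \<kappa>)"
      using integrable_poly_bessel[OF assms(2)] by (auto simp: L2_bessel_iff n)
  qed
qed

end
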